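(* (a) Let $\Omega\subset\mathbb{R}^{n+1}$ be a bounded, convex, open set with smooth boundary and let $u_0\in\mathbb{R}$. Suppose that $u\in C^1(\overline\Omega)$ has a single critical point, $p\in\Omega$, is twice differentiable in $\Omega\setminus\{p\}$, and satisfies $$-|Du|\,\mathrm{div}\left(\frac{Du}{|Du|}\right)=1\ \text{ in }\Omega\setminus\{p\},\qquad u\equiv u_0\ \text{ on }\partial\Omega.$$ Then $\sqrt{2(u-u_0)}$ is concave. (b) Let $\Omega\subset\mathbb{R}^{n+1}$ be a convex, open set with smooth (possibly empty) boundary, not necessarily bounded. Suppose that $u\in C^1(\Omega)$ has a single critical point, $p\in\Omega$, is twice differentiable in $\Omega\setminus\{p\}$, satisfies $$-|Du|\,\mathrm{div}\left(\frac{Du}{|Du|}\right)=1\ \text{ in }\Omega\setminus\{p\},$$ satisfies the boundary condition $u\equiv-\infty$ on $\partial\Omega$, and has bounded and convex level sets. Then $u$ is concave.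
   Context: In (b), the boundary condition $u\equiv-\infty$ on $\partial\Omega$ means that $u(x)\to-\infty$ as $x$ tends to any point of $\partial\Omega$ (a vacuous condition if $\partial\Omega=\emptyset$), and "bounded and convex level sets" means that for every $t<u(p)$ the set $\{q\in\Omega:u(q)>t\}$ bounded by the level set $\{u=t\}$ is bounded and convex. *)

theory Defs
  imports "HOL-Analysis.Analysis"
begin

definition grad :: "(real ^ 'n \<Rightarrow> real) \<Rightarrow> real ^ 'n \<Rightarrow> real ^ 'n"
  where "grad f x = (\<chi> i. frechet_derivative f (at x) (axis i 1))"

lemma grad_GDERIV:
  assumes "f differentiable (at x)"
  shows "GDERIV f x :> grad f x"
proof -
  let ?D = "frechet_derivative f (at x)"
  have D: "(f has_derivative ?D) (at x)"
    using assms frechet_derivative_works by blast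
  then have lin: "linear ?D"
    by (rule has_derivative_linear)
  have "?D h = h \<bullet> grad f x" for h
  proof -
    have "?D h = ?D (\<Sum>i\<in>UNIV. (h $ i) *\<^sub>R axis i 1)"
      using basis_expansion[of h] by (simp add: scalar_mult_eq_scaleR)
    also have "\<dots> = (\<Sum>i\<in>UNIV. (h $ i) * ?D (axis i 1))"
      by (simp add: linear_sum[OF lin] linear_cmul[OF lin])
    finally show ?thesis
      by (simp add: grad_def inner_vec_def)
  qed
  then have "?D = (\<lambda>h. h \<bullet> grad f x)" by auto
  with D show ?thesis unfolding gderiv_def by simp
qed

definition divergence :: "(real ^ 'n \<Rightarrow> real ^ 'n) \<Rightarrow> real ^ 'n \<Rightarrow> real"
  where "divergence F x = (\<Sum>i\<in>UNIV. frechet_derivative F (at x) (axis i 1) $ i)"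

(* Meant for open sets only. *)
primrec Ck_on :: "nat \<Rightarrow> (real ^ 'n) set \<Rightarrow> (real ^ 'n \<Rightarrow> real) \<Rightarrow> bool"
  where
    "Ck_on 0 U f \<longleftrightarrow> continuous_on U f"
  | "Ck_on (Suc k) U f \<longleftrightarrow>
       (\<forall>x\<in>U. f differentiable (at x)) \<and>
       (\<forall>v. Ck_on k U (\<lambda>x. frechet_derivative f (at x) v))"

definition smooth_on :: "(real ^ 'n) set \<Rightarrow> (real ^ 'n \<Rightarrow> real) \<Rightarrow> bool"
  where "smooth_on U f \<longleftrightarrow> (\<forall>k. Ck_on k U f)"

(* The set is locally a sublevel set of a smooth function without critical points; hence its
   frontier is locally the zero set of that function, with the set on one side only.
   An empty frontier counts as smooth. *)
definition smooth_boundary :: "(real ^ 'n) set \<Rightarrow> bool"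
  where "smooth_boundary \<Omega> \<longleftrightarrow>
    (\<forall>x\<in>frontier \<Omega>. \<exists>U \<phi>. open U \<and> x \<in> U \<and> smooth_on U \<phi> \<and>
       (\<forall>y\<in>U. grad \<phi> y \<noteq> 0) \<and> \<Omega> \<inter> U = {y \<in> U. \<phi> y < 0})"

(* C^1 up to the boundary of an open set: the function is continuous on the closure, and its
   gradient on the open set extends continuously to the closure. *)
definition C1_on_closure :: "(real ^ 'n) set \<Rightarrow> (real ^ 'n \<Rightarrow> real) \<Rightarrow> bool"
  where "C1_on_closure \<Omega> u \<longleftrightarrow>
    continuous_on (closure \<Omega>) u \<and> (\<forall>x\<in>\<Omega>. u differentiable (at x)) \<and>
    (\<exists>G. continuous_on (closure \<Omega>) G \<and> (\<forall>x\<in>\<Omega>. G x = grad u x))"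

(* The value at a point of the closure of the continuous extension of the gradient; it does not
   depend on the values of u outside the open set. *)
definition closure_grad :: "(real ^ 'n) set \<Rightarrow> (real ^ 'n \<Rightarrow> real) \<Rightarrow> real ^ 'n \<Rightarrow> real ^ 'n"
  where "closure_grad \<Omega> u x = Lim (at x within \<Omega>) (grad u)"

lemma closure_grad_eq:
  assumes "open \<Omega>" "continuous_on (closure \<Omega>) G" "\<And>y. y \<in> \<Omega> \<Longrightarrow> G y = grad u y"
    and x: "x \<in> closure \<Omega>"
  shows "closure_grad \<Omega> u x = G x"
proof -
  have "(G \<longlongrightarrow> G x) (at x within closure \<Omega>)"
    using assms(2) x by (simp add: continuous_on_def)
  then have "(G \<longlongrightarrow> G x) (at x within \<Omega>)"
    by (rule tendsto_within_subset) (rule closure_subset)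
  moreover have "eventually (\<lambda>y. G y = grad u y) (at x within \<Omega>)"
    using assms(3) by (simp add: eventually_at_filter)
  ultimately have lim: "(grad u \<longlongrightarrow> G x) (at x within \<Omega>)"
    by (rule Lim_transform_eventually)
  have "x islimpt \<Omega>"
  proof (cases "x \<in> \<Omega>")
    case True
    then show ?thesis using assms(1) by (simp add: interior_limit_point interior_open)
  next
    case False
    then show ?thesis using x by (simp add: closure_def)
  qed
  then have "at x within \<Omega> \<noteq> bot"
    by (simp add: trivial_limit_within)
  then show ?thesis
    unfolding closure_grad_def using lim by (rule tendsto_Lim)
qed

(* Twice differentiable in the pointwise (Frechet) sense on an open set; the second derivative
   need not be continuous. *)
definition twice_differentiable_on_open :: "(real ^ 'n) set \<Rightarrow> (real ^ 'n \<Rightarrow> real) \<Rightarrow> bool"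
  where "twice_differentiable_on_open A u \<longleftrightarrow>
    (\<forall>x\<in>A. u differentiable (at x)) \<and> (\<forall>x\<in>A. grad u differentiable (at x))"

definition arrival_time_eq :: "(real ^ 'n) set \<Rightarrow> (real ^ 'n \<Rightarrow> real) \<Rightarrow> bool"
  where "arrival_time_eq A u \<longleftrightarrow>
    (\<forall>x\<in>A. - norm (grad u x) * divergence (\<lambda>y. grad u y /\<^sub>R norm (grad u y)) x = 1)"

end

(* In terms of v = sqrt (2 (u - u0)) the equation says that the second derivative of v, traced over
   the tangent space of the level set, is -1/v. If the two-point function
   v (l x + m y) - l v x - m v y (l + m = 1 fixed) has an interior minimum at (x, y), then the
   gradients of v at x, y and z = l x + m y agree, so these points share their tangent directions.
   The second derivative test for the displacements v x * xi of x and v y * xi of y, summed over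
   tangent xi, gives - M^2 / v z + M >= 0 with M = l v x + m v y, that is, M <= v z. At a minimum
   with x or y on the boundary, the infinite inward slope of v is contradictory. For (b), apply this
   to the sets {u > t} and let t tend to minus infinity. *)

theory Submission
  imports Defs "HOL-Real_Asymp.Real_Asymp"
begin

section \<open>Calculus: a pointwise second derivative test and the normalized divergence\<close>

text \<open>Only the derivative \<open>k\<close> of \<open>g'\<close> at the single point 0 is at
  hand, since the second derivative of \<open>u\<close> is merely pointwise. If
  \<open>k < 0\<close>, then \<open>g'\<close> is negative just to the right of 0, and the mean
  value theorem gives a smaller value of \<open>g\<close> there.\<close>

lemma second_derivative_nonneg_at_min:
  fixes g g' :: "real \<Rightarrow> real"
  assumes d: "d > 0"
    and g: "\<And>t. \<bar>t\<bar> < d \<Longrightarrow> (g has_real_derivative g' t) (at t)"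
    and g': "(g' has_real_derivative k) (at 0)"
    and min: "\<And>t. \<bar>t\<bar> < d \<Longrightarrow> g 0 \<le> g t"
  shows "0 \<le> k"
proof (rule ccontr)
  assume "\<not> 0 \<le> k"
  then have "k < 0" by simp
  have g'0: "g' 0 = 0"
    using DERIV_local_min[OF g[of 0] d] d min by auto
  obtain e where e: "e > 0" "\<And>h. 0 < h \<Longrightarrow> h < e \<Longrightarrow> g' h < 0"
    using DERIV_neg_dec_right[OF g' \<open>k < 0\<close>] g'0 by auto
  define b where "b = min d e / 2"
  have b: "0 < b" "b < d" "b < e" using d e(1) by (auto simp: b_def)
  obtain z where z: "0 < z" "z < b" "g b - g 0 = (b - 0) * g' z"
    using MVT2[of 0 b g g'] g b by auto
  have "g' z < 0" using e(2) z b by simp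
  then have "g b < g 0" using z(3) b(1) mult_pos_neg[of b "g' z"] by simp
  then show False using min[of b] b by simp
qed

lemma inner_linear_expansion:
  fixes h :: "real ^ 'n \<Rightarrow> real ^ 'm"
  assumes lin: "linear h"
  shows "(\<Sum>i\<in>UNIV. x $ i * (w \<bullet> h (axis i 1))) = w \<bullet> h x"
proof -
  have "w \<bullet> h x = w \<bullet> h (\<Sum>i\<in>UNIV. x $ i *\<^sub>R axis i 1)"
    using basis_expansion[of x] by (simp add: scalar_mult_eq_scaleR)
  then show ?thesis
    by (simp add: linear_sum[OF lin] linear_cmul[OF lin] inner_sum_right)
qed

text \<open>The vectors \<open>axis i 1 - \<nu> $ i *\<^sub>R \<nu>\<close> are the projections of
  the standard basis to the hyperplane normal to \<open>\<nu>\<close>. Summing the quadratic form of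
  \<open>h\<close> over them yields its trace on that hyperplane, with no orthonormal basis of the
  hyperplane to choose.\<close>

lemma projected_trace:
  fixes h :: "real ^ 'n \<Rightarrow> real ^ 'n"
  assumes lin: "linear h" and nu: "norm \<nu> = 1"
  shows "(\<Sum>i\<in>UNIV. (axis i 1 - \<nu> $ i *\<^sub>R \<nu>) \<bullet> h (axis i 1 - \<nu> $ i *\<^sub>R \<nu>))
    = (\<Sum>i\<in>UNIV. h (axis i 1) $ i) - \<nu> \<bullet> h \<nu>"
proof -
  have nu2: "\<nu> \<bullet> \<nu> = 1" using nu by (simp add: norm_eq_1)
  have s1: "(\<Sum>i\<in>UNIV. \<nu> $ i * (\<nu> \<bullet> h (axis i 1))) = \<nu> \<bullet> h \<nu>"
    by (rule inner_linear_expansion[OF lin])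
  have s2: "(\<Sum>i\<in>UNIV. \<nu> $ i * h \<nu> $ i) = \<nu> \<bullet> h \<nu>"
    by (simp add: inner_vec_def)
  have s3: "(\<Sum>i\<in>UNIV. \<nu> $ i * \<nu> $ i * (\<nu> \<bullet> h \<nu>)) = \<nu> \<bullet> h \<nu>"
    using nu2 by (simp add: inner_vec_def flip: sum_distrib_right)
  have "(axis i 1 - \<nu> $ i *\<^sub>R \<nu>) \<bullet> h (axis i 1 - \<nu> $ i *\<^sub>R \<nu>)
     = h (axis i 1) $ i - \<nu> $ i * h \<nu> $ i - \<nu> $ i * (\<nu> \<bullet> h (axis i 1)) + \<nu> $ i * \<nu> $ i * (\<nu> \<bullet> h \<nu>)" for i
    by (simp add: linear_diff[OF lin] linear_cmul[OF lin] inner_diff_left inner_diff_right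
        inner_axis' algebra_simps)
  then show ?thesis
    by (simp add: sum.distrib sum_subtractf s1 s2 s3)
qed

text \<open>By the quotient rule, the derivative of the normalized field is
  \<open>H / norm (F x)\<close> with its component along \<open>sgn (F x)\<close> removed. When
  \<open>F\<close> is a gradient, the right-hand side is the trace of the second derivative over the
  tangent space of the level set.\<close>

lemma divergence_normalized:
  fixes F :: "real ^ 'n \<Rightarrow> real ^ 'n"
  assumes F: "(F has_derivative H) (at x)" and nz: "F x \<noteq> 0"
  shows "norm (F x) * divergence (\<lambda>y. F y /\<^sub>R norm (F y)) x
    = (\<Sum>i\<in>UNIV. H (axis i 1) $ i) - sgn (F x) \<bullet> H (sgn (F x))"
proof -
  let ?n = "norm (F x)"
  let ?\<nu> = "sgn (F x)"
  have lin: "linear H" using F by (rule has_derivative_linear)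
  have n: "?n > 0" using nz by simp
  have D: "((\<lambda>y. F y /\<^sub>R norm (F y)) has_derivative
      (\<lambda>h. H h /\<^sub>R ?n - ((?\<nu> \<bullet> H h) / ?n) *\<^sub>R ?\<nu>)) (at x)"
  proof (rule has_derivative_eq_rhs)
    have "((\<lambda>y. norm (F y)) has_derivative (\<lambda>h. H h \<bullet> ?\<nu>)) (at x)"
      by (rule has_derivative_compose[OF F has_derivative_norm[OF nz]])
    with nz have "((\<lambda>y. inverse (norm (F y))) has_derivative
        (\<lambda>h. - (inverse ?n * (H h \<bullet> ?\<nu>) * inverse ?n))) (at x)"
      by (intro Deriv.has_derivative_inverse) auto
    from has_derivative_scaleR[OF this F]
    show "((\<lambda>y. F y /\<^sub>R norm (F y)) has_derivative (\<lambda>h. inverse ?n *\<^sub>R H h +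
        - (inverse ?n * (H h \<bullet> ?\<nu>) * inverse ?n) *\<^sub>R F x)) (at x)" .
  qed (auto simp: sgn_div_norm inner_commute divide_inverse mult_ac)
  have s: "(\<Sum>i\<in>UNIV. (?\<nu> \<bullet> H (axis i 1)) * ?\<nu> $ i) = ?\<nu> \<bullet> H ?\<nu>"
    using inner_linear_expansion[OF lin, of ?\<nu> ?\<nu>] by (simp add: mult.commute)
  have "divergence (\<lambda>y. F y /\<^sub>R norm (F y)) x
     = (\<Sum>i\<in>UNIV. (H (axis i 1) $ i - (?\<nu> \<bullet> H (axis i 1)) * ?\<nu> $ i) / ?n)"
    unfolding divergence_def frechet_derivative_at[OF D, symmetric]
    by (simp add: divide_inverse algebra_simps)
  then show ?thesis using n s
    by (simp add: sum_subtractf flip: sum_divide_distrib)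
qed

section \<open>The equation on a bounded convex domain\<close>

text \<open>One setting for both parts: the domain is the given one in (a) and a superlevel set in
  (b). \<open>G\<close> is the gradient extended continuously to the closure, which gives it a
  meaning at frontier points; \<open>eq\<close> is the equation rewritten by
  \<open>divergence_normalized\<close>.\<close>

locale arrival_time =
  fixes \<Omega> :: "(real ^ 'n) set" and u :: "real ^ 'n \<Rightarrow> real" and u0 :: real and p :: "real ^ 'n"
    and G :: "real ^ 'n \<Rightarrow> real ^ 'n" and H :: "real ^ 'n \<Rightarrow> real ^ 'n \<Rightarrow> real ^ 'n"
  assumes bounded: "bounded \<Omega>" and convex: "convex \<Omega>" and open_dom: "open \<Omega>" and p: "p \<in> \<Omega>"
    and cont_u: "continuous_on (closure \<Omega>) u"
    and cont_G: "continuous_on (closure \<Omega>) G"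
    and du: "\<And>x. x \<in> \<Omega> \<Longrightarrow> (u has_derivative (\<lambda>h. h \<bullet> G x)) (at x)"
    and Gp: "G p = 0" and G_nz: "\<And>x. x \<in> closure \<Omega> \<Longrightarrow> x \<noteq> p \<Longrightarrow> G x \<noteq> 0"
    and dG: "\<And>x. x \<in> \<Omega> \<Longrightarrow> x \<noteq> p \<Longrightarrow> (G has_derivative H x) (at x)"
    and eq: "\<And>x. x \<in> \<Omega> \<Longrightarrow> x \<noteq> p \<Longrightarrow>
      (\<Sum>i\<in>UNIV. H x (axis i 1) $ i) - sgn (G x) \<bullet> H x (sgn (G x)) = -1"
    and bdry: "\<And>x. x \<in> frontier \<Omega> \<Longrightarrow> u x = u0"
begin

text \<open>Each summand is a second derivative of \<open>u\<close> along a line tangent to the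
  level set, so one-dimensional second derivative tests can be summed and compared with the
  equation.\<close>

lemma eq_projected:
  assumes "x \<in> \<Omega>" "x \<noteq> p"
  shows "(\<Sum>i\<in>UNIV. (axis i 1 - sgn (G x) $ i *\<^sub>R sgn (G x)) \<bullet>
      H x (axis i 1 - sgn (G x) $ i *\<^sub>R sgn (G x))) = -1"
proof -
  have "G x \<noteq> 0" using G_nz assms closure_subset by blast
  then have "norm (sgn (G x)) = 1" by (simp add: norm_sgn)
  from projected_trace[OF has_derivative_linear[OF dG[OF assms]] this] eq[OF assms]
  show ?thesis by simp
qed

lemma derivative_along_line:
  assumes "x + t *\<^sub>R \<xi> \<in> \<Omega>"
  shows "((\<lambda>t. u (x + t *\<^sub>R \<xi>)) has_real_derivative (\<xi> \<bullet> G (x + t *\<^sub>R \<xi>))) (at t)"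
proof -
  have "((\<lambda>t. x + t *\<^sub>R \<xi>) has_derivative (\<lambda>t. t *\<^sub>R \<xi>)) (at t)"
    by (auto intro!: derivative_eq_intros)
  from has_derivative_compose[OF this du[OF assms]] show ?thesis
    by (simp add: has_field_derivative_def mult_commute_abs)
qed

lemma second_derivative_along_line:
  assumes "x \<in> \<Omega>" "x \<noteq> p"
  shows "((\<lambda>t. \<xi> \<bullet> G (x + t *\<^sub>R \<xi>)) has_real_derivative (\<xi> \<bullet> H x \<xi>)) (at 0)"
proof -
  have "((\<lambda>t. x + t *\<^sub>R \<xi>) has_derivative (\<lambda>t. t *\<^sub>R \<xi>)) (at 0)"
    by (auto intro!: derivative_eq_intros)
  moreover have "(G has_derivative H x) (at (x + 0 *\<^sub>R \<xi>))"
    using dG[OF assms] by simp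
  ultimately have "((\<lambda>t. G (x + t *\<^sub>R \<xi>)) has_derivative (\<lambda>t. H x (t *\<^sub>R \<xi>))) (at 0)"
    by (rule has_derivative_compose)
  then have "((\<lambda>t. \<xi> \<bullet> G (x + t *\<^sub>R \<xi>)) has_derivative (\<lambda>t. \<xi> \<bullet> H x (t *\<^sub>R \<xi>))) (at 0)"
    by (rule has_derivative_inner_right)
  then show ?thesis
    by (simp add: has_field_derivative_def mult_commute_abs
        linear_cmul[OF has_derivative_linear[OF dG[OF assms]]])
qed

lemma line_in_domain:
  assumes "x \<in> \<Omega>"
  obtains d where "d > 0" "\<And>t. \<bar>t\<bar> < d \<Longrightarrow> x + t *\<^sub>R \<xi> \<in> \<Omega>"
proof -
  obtain e where e: "e > 0" "ball x e \<subseteq> \<Omega>"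
    using open_dom assms by (auto simp: open_contains_ball)
  have "x + t *\<^sub>R \<xi> \<in> \<Omega>" if "\<bar>t\<bar> < e / (norm \<xi> + 1)" for t
  proof -
    have "\<bar>t\<bar> * norm \<xi> \<le> \<bar>t\<bar> * (norm \<xi> + 1)" by (simp add: mult_left_mono)
    also have "\<dots> < e" using that by (simp add: pos_less_divide_eq add_nonneg_pos)
    finally show ?thesis using e(2) by (auto simp: dist_norm)
  qed
  moreover have "e / (norm \<xi> + 1) > 0" using e(1) by (simp add: add_nonneg_pos)
  ultimately show ?thesis using that by blast
qed

section \<open>Minimum principle and strict positivity of \<open>u - u0\<close>\<close>

lemma closure_cases: "x \<in> closure \<Omega> \<Longrightarrow> x \<in> \<Omega> \<or> x \<in> frontier \<Omega>"
  using open_dom by (simp add: frontier_def interior_open)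

lemma compact_closure: "compact (closure \<Omega>)"
  using bounded by simp

text \<open>A smaller interior minimum would stay interior after adding a small linear function;
  the new minimum is not critical for \<open>u\<close>, where the equation excludes a positive semidefinite
  second derivative.\<close>

lemma u_ge: assumes q: "q \<in> closure \<Omega>" shows "u0 \<le> u q"
proof (rule ccontr)
  assume "\<not> u0 \<le> u q"
  then have lt: "u q < u0" by simp
  define b :: "real ^ 'n" where "b = axis undefined 1"
  have b: "b \<noteq> 0" by (simp add: b_def axis_eq_0_iff)
  obtain B where B: "B > 0" "\<And>x. x \<in> closure \<Omega> \<Longrightarrow> norm x \<le> B"
    using bounded_closure[OF bounded] bounded_pos by blast
  have bB: "\<bar>b \<bullet> x\<bar> \<le> B" if "x \<in> closure \<Omega>" for x
    using Cauchy_Schwarz_ineq2[of b x] B(2)[OF that] by (simp add: b_def)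
  \<comment> \<open>The linear term varies by at most \<open>2 * \<epsilon> * B\<close> over the
    closure, two thirds of the gap \<open>u0 - u q\<close>, so a minimum of the perturbed function
    cannot lie on the frontier.\<close>
  define \<epsilon> where "\<epsilon> = (u0 - u q) / (3 * B)"
  have eps: "\<epsilon> > 0" "\<epsilon> * B * 3 = u0 - u q" using lt B(1) by (auto simp: \<epsilon>_def)
  let ?f = "\<lambda>x. u x + \<epsilon> * (b \<bullet> x)"
  have "continuous_on (closure \<Omega>) ?f" by (intro continuous_intros cont_u)
  then obtain x where x: "x \<in> closure \<Omega>" "\<And>y. y \<in> closure \<Omega> \<Longrightarrow> ?f x \<le> ?f y"
    using continuous_attains_inf[OF compact_closure, of ?f] q by (metis empty_iff)
  have "x \<in> \<Omega>"
  proof (rule ccontr)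
    assume "x \<notin> \<Omega>"
    then have "u x = u0" using closure_cases[OF x(1)] bdry by blast
    moreover have "\<epsilon> * (b \<bullet> x) \<ge> - (\<epsilon> * B)" "\<epsilon> * (b \<bullet> q) \<le> \<epsilon> * B"
      using bB[OF x(1)] bB[OF q] mult_left_mono[of "-B" "b \<bullet> x" \<epsilon>] mult_left_mono[of "b \<bullet> q" B \<epsilon>] eps(1) by auto
    ultimately show False using x(2)[OF q] eps lt mult_pos_pos[OF eps(1) B(1)] by linarith
  qed
  have "(\<lambda>h. h \<bullet> G x + \<epsilon> * (b \<bullet> h)) = (\<lambda>h. 0)"
  proof (rule differential_zero_maxmin[OF \<open>x \<in> \<Omega>\<close> open_dom])
    show "(?f has_derivative (\<lambda>h. h \<bullet> G x + \<epsilon> * (b \<bullet> h))) (at x)"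
      by (intro has_derivative_add du[OF \<open>x \<in> \<Omega>\<close>] has_derivative_mult_right
          has_derivative_inner_right has_derivative_ident)
    show "(\<forall>y\<in>\<Omega>. ?f y \<le> ?f x) \<or> (\<forall>y\<in>\<Omega>. ?f x \<le> ?f y)"
      using x(2) closure_subset by blast
  qed
  then have "w \<bullet> (G x + \<epsilon> *\<^sub>R b) = 0" for w
    by (simp add: inner_add_right inner_commute[of w b] fun_eq_iff)
  from this[of "G x + \<epsilon> *\<^sub>R b"] have "G x = - (\<epsilon> *\<^sub>R b)" by (simp add: eq_neg_iff_add_eq_0)
  then have "x \<noteq> p" using Gp b eps(1) by auto
  have pos: "0 \<le> \<xi> \<bullet> H x \<xi>" for \<xi>
  proof -
    obtain d where d: "d > 0" "\<And>t. \<bar>t\<bar> < d \<Longrightarrow> x + t *\<^sub>R \<xi> \<in> \<Omega>"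
      using line_in_domain[OF \<open>x \<in> \<Omega>\<close>] by blast
    show ?thesis
    proof (rule second_derivative_nonneg_at_min[OF d(1)])
      show "((\<lambda>t. u (x + t *\<^sub>R \<xi>) + \<epsilon> * (b \<bullet> (x + t *\<^sub>R \<xi>))) has_real_derivative
          \<xi> \<bullet> G (x + t *\<^sub>R \<xi>) + \<epsilon> * (b \<bullet> \<xi>)) (at t)" if "\<bar>t\<bar> < d" for t
      proof (rule DERIV_add[OF derivative_along_line[OF d(2)[OF that]]])
        show "((\<lambda>t. \<epsilon> * (b \<bullet> (x + t *\<^sub>R \<xi>))) has_real_derivative \<epsilon> * (b \<bullet> \<xi>)) (at t)"
          unfolding inner_add_right inner_scaleR_right by (auto intro!: derivative_eq_intros)
      qed
      show "((\<lambda>t. \<xi> \<bullet> G (x + t *\<^sub>R \<xi>) + \<epsilon> * (b \<bullet> \<xi>)) has_real_derivative \<xi> \<bullet> H x \<xi>) (at 0)"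
        using DERIV_add[OF second_derivative_along_line[OF \<open>x \<in> \<Omega>\<close> \<open>x \<noteq> p\<close>] DERIV_const]
        by simp
      show "u (x + 0 *\<^sub>R \<xi>) + \<epsilon> * (b \<bullet> (x + 0 *\<^sub>R \<xi>)) \<le> u (x + t *\<^sub>R \<xi>) + \<epsilon> * (b \<bullet> (x + t *\<^sub>R \<xi>))"
        if "\<bar>t\<bar> < d" for t
        using x(2)[of "x + t *\<^sub>R \<xi>"] d(2)[OF that] closure_subset by (auto simp: subset_iff)
    qed
  qed
  show False
    using eq_projected[OF \<open>x \<in> \<Omega>\<close> \<open>x \<noteq> p\<close>]
      sum_nonneg[of UNIV "\<lambda>i. (axis i 1 - sgn (G x) $ i *\<^sub>R sgn (G x)) \<bullet>
      H x (axis i 1 - sgn (G x) $ i *\<^sub>R sgn (G x))"] pos by simp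
qed

lemma critical_extremum:
  assumes "x \<in> \<Omega>" "(\<forall>y\<in>\<Omega>. u y \<le> u x) \<or> (\<forall>y\<in>\<Omega>. u x \<le> u y)"
  shows "x = p"
proof -
  have "(\<lambda>h. h \<bullet> G x) = (\<lambda>h. 0)"
    by (rule differential_zero_maxmin[OF assms(1) open_dom du[OF assms(1)] assms(2)])
  then have "G x \<bullet> G x = 0" by (simp add: fun_eq_iff)
  then show ?thesis using G_nz assms(1) closure_subset by auto
qed

text \<open>A point of \<Omega> with value \<open>u0\<close> would be a minimum by
  \<open>u_ge\<close>, hence equal to \<open>p\<close>. All other values in \<Omega> then exceed
  \<open>u0\<close>, so the maximum is attained in \<Omega> as well; it is critical, hence again at
  \<open>p\<close>, which is absurd.\<close>

lemma u_gt: assumes q: "q \<in> \<Omega>" shows "u0 < u q"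
proof (rule ccontr)
  assume "\<not> u0 < u q"
  then have uq: "u q = u0" using u_ge[of q] q closure_subset by force
  then have "q = p"
    using critical_extremum[OF q] u_ge closure_subset by auto
  have gt: "u0 < u y" if "y \<in> \<Omega>" "y \<noteq> p" for y
    using critical_extremum[OF that(1)] u_ge that closure_subset
    by (metis in_mono order_le_less)
  obtain d where d: "d > 0" "\<And>t. \<bar>t\<bar> < d \<Longrightarrow> p + t *\<^sub>R axis undefined 1 \<in> \<Omega>"
    using line_in_domain[OF p] by blast
  define y where "y = p + (d/2) *\<^sub>R axis undefined 1"
  have y: "y \<in> \<Omega>" "y \<noteq> p" using d by (auto simp: y_def axis_eq_0_iff)
  obtain x where x: "x \<in> closure \<Omega>" "\<And>y. y \<in> closure \<Omega> \<Longrightarrow> u y \<le> u x"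
    using continuous_attains_sup[OF compact_closure _ cont_u] p closure_subset by blast
  have "u0 < u x" using x(2)[of y] gt[OF y] y closure_subset by force
  then have "x \<in> \<Omega>" using closure_cases[OF x(1)] bdry by force
  then have "x = p" using critical_extremum x(2) closure_subset by blast
  then show False using \<open>u0 < u x\<close> \<open>q = p\<close> uq by simp
qed

section \<open>First-order behaviour at the frontier\<close>

lemma segment_to_interior:
  assumes "x \<in> closure \<Omega>" "q \<in> \<Omega>" "0 < s" "s \<le> 1"
  shows "x + s *\<^sub>R (q - x) \<in> \<Omega>"
proof -
  have "x - s *\<^sub>R (x - q) \<in> interior \<Omega>"
    using mem_interior_closure_convex_shrink[OF convex _ assms(1) assms(3,4)] assms(2) open_dom
    by (simp add: interior_open)
  then show ?thesis using open_dom by (simp add: interior_open algebra_simps)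
qed

text \<open>Differentiability of \<open>u\<close> is known only inside \<Omega>. The mean value
  theorem on the segment towards \<open>q\<close> turns the difference quotient into a value of
  \<open>G\<close> at an interior point, and continuity of \<open>G\<close> up to the closure
  compares it with \<open>G x\<close>.\<close>

lemma expansion_at_frontier:
  assumes x: "x \<in> frontier \<Omega>" and q: "q \<in> \<Omega>" and \<eta>: "\<eta> > 0"
  obtains d where "d > 0" "d \<le> 1"
    "\<And>s. 0 < s \<Longrightarrow> s < d \<Longrightarrow> \<bar>u (x + s *\<^sub>R (q - x)) - u0 - s * ((q - x) \<bullet> G x)\<bar> \<le> \<eta> * s"
proof -
  let ?e = "q - x"
  have xc: "x \<in> closure \<Omega>" using x by (simp add: frontier_def)
  have cl: "x + s *\<^sub>R ?e \<in> closure \<Omega>" if "0 \<le> s" "s \<le> 1" for s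
  proof (cases "s = 0")
    case True
    then show ?thesis using xc by simp
  next
    case False
    then show ?thesis using segment_to_interior[OF xc q, of s] that closure_subset by auto
  qed
  have "continuous_on {0..1} (\<lambda>s. ?e \<bullet> G (x + s *\<^sub>R ?e))"
    by (intro continuous_intros continuous_on_compose2[OF cont_G]) (auto intro: cl)
  then obtain d where d: "d > 0"
    "\<And>s. s \<in> {0..1} \<Longrightarrow> dist s 0 < d \<Longrightarrow> dist (?e \<bullet> G (x + s *\<^sub>R ?e)) (?e \<bullet> G (x + 0 *\<^sub>R ?e)) < \<eta>"
    using \<eta> unfolding continuous_on_iff by (metis atLeastAtMost_iff order_refl zero_le_one)
  have "\<bar>u (x + s *\<^sub>R ?e) - u0 - s * (?e \<bullet> G x)\<bar> \<le> \<eta> * s" if s: "0 < s" "s < min d 1" for s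
  proof -
    have "continuous_on {0..s} (\<lambda>s. u (x + s *\<^sub>R ?e))"
      using s by (intro continuous_intros continuous_on_compose2[OF cont_u]) (auto intro: cl)
    moreover have "((\<lambda>s. u (x + s *\<^sub>R ?e)) has_derivative (\<lambda>h. (?e \<bullet> G (x + r *\<^sub>R ?e)) * h)) (at r)"
      if "0 < r" "r < s" for r
      using derivative_along_line[OF segment_to_interior[OF xc q, of r]] that s
      by (simp add: has_field_derivative_def)
    ultimately obtain r where r: "0 < r" "r < s"
      "u (x + s *\<^sub>R ?e) - u (x + 0 *\<^sub>R ?e) = (?e \<bullet> G (x + r *\<^sub>R ?e)) * (s - 0)"
      using mvt[OF s(1), of "\<lambda>s. u (x + s *\<^sub>R ?e)" "\<lambda>r h. (?e \<bullet> G (x + r *\<^sub>R ?e)) * h"]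
      by blast
    have "u (x + s *\<^sub>R ?e) - u0 - s * (?e \<bullet> G x) = s * (?e \<bullet> G (x + r *\<^sub>R ?e) - ?e \<bullet> G x)"
      using r(3) bdry[OF x] by (simp add: algebra_simps)
    moreover have "\<bar>?e \<bullet> G (x + r *\<^sub>R ?e) - ?e \<bullet> G x\<bar> \<le> \<eta>"
      using d(2)[of r] r s by (simp add: dist_real_def)
    ultimately show ?thesis using s(1) by (simp add: abs_mult mult.commute mult_left_mono)
  qed
  then show ?thesis using that[of "min d 1"] d(1) by auto
qed

text \<open>Derivatives towards points of \<Omega> are nonnegative because \<open>u > u0\<close>
  there. Strictness comes from openness: the same bound holds for \<open>p\<close> shifted slightly
  along \<open>- G x\<close>, and \<open>G x\<close> is nonzero on the frontier.\<close>

lemma inward_derivative_pos: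
  assumes x: "x \<in> frontier \<Omega>"
  shows "0 < (p - x) \<bullet> G x"
proof -
  have xc: "x \<in> closure \<Omega>" and "x \<notin> \<Omega>"
    using x open_dom by (auto simp: frontier_def interior_open)
  have nonneg: "0 \<le> (q - x) \<bullet> G x" if q: "q \<in> \<Omega>" for q
  proof (rule ccontr)
    assume "\<not> 0 \<le> (q - x) \<bullet> G x"
    then have neg: "(q - x) \<bullet> G x < 0" by simp
    obtain d where d: "d > 0" "d \<le> 1"
      "\<And>s. 0 < s \<Longrightarrow> s < d \<Longrightarrow> \<bar>u (x + s *\<^sub>R (q - x)) - u0 - s * ((q - x) \<bullet> G x)\<bar> \<le> - ((q - x) \<bullet> G x) * s"
      using expansion_at_frontier[OF x q, of "- ((q - x) \<bullet> G x)"] neg by auto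
    have "u (x + (d/2) *\<^sub>R (q - x)) \<le> u0"
      using d(3)[of "d/2"] d(1) by (simp add: abs_le_iff mult.commute)
    moreover have "x + (d/2) *\<^sub>R (q - x) \<in> \<Omega>"
      using segment_to_interior[OF xc q, of "d/2"] d by simp
    ultimately show False using u_gt by fastforce
  qed
  obtain d where d: "d > 0" "\<And>t. \<bar>t\<bar> < d \<Longrightarrow> p + t *\<^sub>R G x \<in> \<Omega>"
    using line_in_domain[OF p] by blast
  have "p + (- (d/2)) *\<^sub>R G x \<in> \<Omega>" using d(2)[of "- (d/2)"] d(1) by simp
  from nonneg[OF this] have "0 \<le> (p - x) \<bullet> G x - d/2 * (G x \<bullet> G x)"
    by (simp add: inner_diff_left algebra_simps)
  moreover have "G x \<bullet> G x > 0" using G_nz[OF xc] p \<open>x \<notin> \<Omega>\<close> by auto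
  ultimately show ?thesis using d(1) mult_pos_pos[of "d/2" "G x \<bullet> G x"] by linarith
qed

section \<open>The square root \<open>v\<close> and its two-point function\<close>

definition v :: "real ^ 'n \<Rightarrow> real" where "v x = sqrt (2 * (u x - u0))"

lemma v_pos: "x \<in> \<Omega> \<Longrightarrow> 0 < v x"
  using u_gt by (simp add: v_def)

lemma v_frontier: "x \<in> frontier \<Omega> \<Longrightarrow> v x = 0"
  using bdry by (simp add: v_def)

lemma cont_v: "continuous_on (closure \<Omega>) v"
  unfolding v_def by (intro continuous_intros cont_u)

lemma v_derivative_along_line:
  assumes "x + t *\<^sub>R \<xi> \<in> \<Omega>"
  shows "((\<lambda>t. v (x + t *\<^sub>R \<xi>)) has_real_derivative
      (\<xi> \<bullet> G (x + t *\<^sub>R \<xi>)) / v (x + t *\<^sub>R \<xi>)) (at t)"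
proof -
  have pos: "0 < 2 * (u (x + t *\<^sub>R \<xi>) - u0)" using u_gt[OF assms] by simp
  have "((\<lambda>t. 2 * (u (x + t *\<^sub>R \<xi>) - u0)) has_real_derivative 2 * (\<xi> \<bullet> G (x + t *\<^sub>R \<xi>) - 0)) (at t)"
    by (intro DERIV_cmult DERIV_diff derivative_along_line[OF assms] DERIV_const)
  from DERIV_chain2[OF DERIV_real_sqrt this, OF pos] show ?thesis
    unfolding v_def[symmetric] by (simp add: inverse_eq_divide)
qed

text \<open>The term \<open>(\<xi> \<bullet> G x)\<^sup>2 / v x ^ 3\<close> of the second derivative drops out
  for \<open>\<xi>\<close> tangent to the level set.\<close>

lemma v_second_derivative_along_line:
  assumes x: "x \<in> \<Omega>" "x \<noteq> p" and tan: "\<xi> \<bullet> G x = 0"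
  shows "((\<lambda>t. (\<xi> \<bullet> G (x + t *\<^sub>R \<xi>)) / v (x + t *\<^sub>R \<xi>)) has_real_derivative
      (\<xi> \<bullet> H x \<xi>) / v x) (at 0)"
proof -
  have "v (x + 0 *\<^sub>R \<xi>) \<noteq> 0" using v_pos[OF x(1)] by simp
  from DERIV_divide[OF second_derivative_along_line[OF x] v_derivative_along_line this]
  show ?thesis using x tan v_pos[OF x(1)] by simp
qed

lemma two_point_interior:
  assumes x: "x \<in> \<Omega>" and y: "y \<in> \<Omega>" and z: "l *\<^sub>R x + m *\<^sub>R y \<in> \<Omega>"
    and l: "0 < l" and m: "0 < m" and lm: "l + m = 1"
    and min: "\<And>x' y'. x' \<in> \<Omega> \<Longrightarrow> y' \<in> \<Omega> \<Longrightarrow>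
      v (l *\<^sub>R x + m *\<^sub>R y) - l * v x - m * v y \<le> v (l *\<^sub>R x' + m *\<^sub>R y') - l * v x' - m * v y'"
  shows "l * v x + m * v y \<le> v (l *\<^sub>R x + m *\<^sub>R y)"
proof -
  define z where "z = l *\<^sub>R x + m *\<^sub>R y"
  note z = z[folded z_def]
  note pos = v_pos[OF x] v_pos[OF y] v_pos[OF z]
  \<comment> \<open>The two-point function while \<open>x\<close> moves with velocity
    \<open>a\<close> and \<open>y\<close> with velocity \<open>b\<close>; the combination
    \<open>z\<close> then moves with velocity \<open>l *\<^sub>R a + m *\<^sub>R b\<close>.\<close>
  define g where "g a b t = v (z + t *\<^sub>R (l *\<^sub>R a + m *\<^sub>R b)) - l * v (x + t *\<^sub>R a) - m * v (y + t *\<^sub>R b)"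
    for a b t
  define g' where "g' a b t = ((l *\<^sub>R a + m *\<^sub>R b) \<bullet> G (z + t *\<^sub>R (l *\<^sub>R a + m *\<^sub>R b))) /
      v (z + t *\<^sub>R (l *\<^sub>R a + m *\<^sub>R b)) - l * ((a \<bullet> G (x + t *\<^sub>R a)) / v (x + t *\<^sub>R a))
      - m * ((b \<bullet> G (y + t *\<^sub>R b)) / v (y + t *\<^sub>R b))" for a b t
  have local: "\<exists>d>0. \<forall>t. \<bar>t\<bar> < d \<longrightarrow>
      (g a b has_real_derivative g' a b t) (at t) \<and> g a b 0 \<le> g a b t" for a b
  proof -
    obtain d1 where d1: "d1 > 0" "\<And>t. \<bar>t\<bar> < d1 \<Longrightarrow> x + t *\<^sub>R a \<in> \<Omega>"
      using line_in_domain[OF x] by blast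
    obtain d2 where d2: "d2 > 0" "\<And>t. \<bar>t\<bar> < d2 \<Longrightarrow> y + t *\<^sub>R b \<in> \<Omega>"
      using line_in_domain[OF y] by blast
    obtain d3 where d3: "d3 > 0" "\<And>t. \<bar>t\<bar> < d3 \<Longrightarrow> z + t *\<^sub>R (l *\<^sub>R a + m *\<^sub>R b) \<in> \<Omega>"
      using line_in_domain[OF z] by blast
    have "(g a b has_real_derivative g' a b t) (at t) \<and> g a b 0 \<le> g a b t"
      if "\<bar>t\<bar> < min d1 (min d2 d3)" for t
    proof
      show "(g a b has_real_derivative g' a b t) (at t)"
        unfolding g_def g'_def
        using that d1 d2 d3 by (intro DERIV_diff DERIV_cmult v_derivative_along_line) auto
      have "z + t *\<^sub>R (l *\<^sub>R a + m *\<^sub>R b) = l *\<^sub>R (x + t *\<^sub>R a) + m *\<^sub>R (y + t *\<^sub>R b)"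
        by (simp add: z_def algebra_simps)
      then show "g a b 0 \<le> g a b t"
        using min[OF d1(2) d2(2), of t t] that by (simp add: g_def z_def)
    qed
    then show ?thesis using d1(1) d2(1) d3(1) by (intro exI[of _ "min d1 (min d2 d3)"]) auto
  qed
  have first: "g' a b 0 = 0" for a b
    using local[of a b] DERIV_local_min[of "g a b" "g' a b 0" 0] by auto
  have second: "0 \<le> k" if "(g' a b has_real_derivative k) (at 0)" for a b k
    using local[of a b] second_derivative_nonneg_at_min[of _ "g a b" "g' a b", OF _ _ that] by blast
  \<comment> \<open>Moving \<open>x\<close> alone compares the gradients of \<open>v\<close> at
    \<open>x\<close> and \<open>z\<close>; the gradient of \<open>v\<close> is \<open>G\<close>
    divided by \<open>v\<close>.\<close>
  have "w \<bullet> (G z /\<^sub>R v z - G x /\<^sub>R v x) = 0" for w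
    using first[of w 0] l pos by (simp add: g'_def inner_diff_right field_simps)
  from this[of "G z /\<^sub>R v z - G x /\<^sub>R v x"] have "G x /\<^sub>R v x = G z /\<^sub>R v z" by simp
  then have Gx: "G x = (v x / v z) *\<^sub>R G z"
    using pos by (metis divide_inverse less_irrefl scaleR_scaleR scaleR_one right_inverse)
  have "w \<bullet> (G z /\<^sub>R v z - G y /\<^sub>R v y) = 0" for w
    using first[of 0 w] m pos by (simp add: g'_def inner_diff_right field_simps)
  from this[of "G z /\<^sub>R v z - G y /\<^sub>R v y"] have "G y /\<^sub>R v y = G z /\<^sub>R v z" by simp
  then have Gy: "G y = (v y / v z) *\<^sub>R G z"
    using pos by (metis divide_inverse less_irrefl scaleR_scaleR scaleR_one right_inverse)
  have crit: "G w = 0 \<longleftrightarrow> w = p" if "w \<in> \<Omega>" for w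
    using G_nz[of w] Gp that closure_subset by auto
  show ?thesis
  proof (cases "G z = 0")
    \<comment> \<open>A common zero gradient forces all three points to be \<open>p\<close>, where
      the claim is an equality.\<close>
    case True
    then have "G x = 0" "G y = 0" using Gx Gy by simp_all
    then have "x = p" "y = p" "z = p" using True crit x y z by blast+
    then show ?thesis using lm by (simp add: z_def flip: distrib_right)
  next
    case False
    then have "G x \<noteq> 0" "G y \<noteq> 0" using Gx Gy pos by simp_all
    with False have np: "x \<noteq> p" "y \<noteq> p" "z \<noteq> p" using crit x y z by blast+
    define \<nu> where "\<nu> = sgn (G z)"
    have nu: "sgn (G x) = \<nu>" "sgn (G y) = \<nu>" "sgn (G z) = \<nu>"
      using pos by (simp_all add: Gx Gy \<nu>_def sgn_scaleR)
    have nu1: "\<nu> \<bullet> \<nu> = 1" using False by (simp add: \<nu>_def norm_sgn flip: norm_eq_1)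
    define \<xi> where "\<xi> i = axis i 1 - \<nu> $ i *\<^sub>R \<nu>" for i
    have "\<xi> i \<bullet> \<nu> = 0" for i
      using nu1 by (simp add: \<xi>_def inner_diff_left inner_axis')
    then have tanz: "\<xi> i \<bullet> G z = 0" for i
      using False by (simp add: \<nu>_def sgn_div_norm)
    have tan: "\<xi> i \<bullet> G x = 0" "\<xi> i \<bullet> G y = 0" for i
      by (simp_all add: Gx Gy tanz)
    define M where "M = l * v x + m * v y"
    have "M > 0" using l m pos by (simp add: M_def add_pos_pos)
    \<comment> \<open>With velocities \<open>v x\<close> and \<open>v y\<close> times
      \<open>\<xi> i\<close>, the point \<open>z\<close> moves with velocity \<open>M\<close> times
      \<open>\<xi> i\<close>. At \<open>x\<close> the factor is
      \<open>(v x)\<^sup>2 / v x = v x\<close>, likewise at \<open>y\<close>, so after summation the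
      two weights add up to exactly \<open>M\<close>.\<close>
    have ineq: "0 \<le> M\<^sup>2 / v z * (\<xi> i \<bullet> H z (\<xi> i)) - l * v x * (\<xi> i \<bullet> H x (\<xi> i)) - m * v y * (\<xi> i \<bullet> H y (\<xi> i))"
      for i
    proof (rule second)
      have lin: "linear (H x)" "linear (H y)" "linear (H z)"
        using dG x y z np has_derivative_linear by blast+
      have c: "l *\<^sub>R v x *\<^sub>R \<xi> i + m *\<^sub>R v y *\<^sub>R \<xi> i = M *\<^sub>R \<xi> i"
        by (simp add: M_def algebra_simps)
      have "(g' (v x *\<^sub>R \<xi> i) (v y *\<^sub>R \<xi> i) has_real_derivative
          ((M *\<^sub>R \<xi> i) \<bullet> H z (M *\<^sub>R \<xi> i)) / v z
          - l * (((v x *\<^sub>R \<xi> i) \<bullet> H x (v x *\<^sub>R \<xi> i)) / v x)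
          - m * (((v y *\<^sub>R \<xi> i) \<bullet> H y (v y *\<^sub>R \<xi> i)) / v y)) (at 0)"
        unfolding g'_def c
        by (intro DERIV_diff DERIV_cmult v_second_derivative_along_line x y z np)
          (simp_all add: tan tanz)
      then show "(g' (v x *\<^sub>R \<xi> i) (v y *\<^sub>R \<xi> i) has_real_derivative
          M\<^sup>2 / v z * (\<xi> i \<bullet> H z (\<xi> i)) - l * v x * (\<xi> i \<bullet> H x (\<xi> i)) - m * v y * (\<xi> i \<bullet> H y (\<xi> i))) (at 0)"
        using pos by (simp add: linear_cmul[OF lin(1)] linear_cmul[OF lin(2)] linear_cmul[OF lin(3)]
            power2_eq_square mult_ac)
    qed
    have tr: "(\<Sum>i\<in>UNIV. \<xi> i \<bullet> H x (\<xi> i)) = -1" "(\<Sum>i\<in>UNIV. \<xi> i \<bullet> H y (\<xi> i)) = -1"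
        "(\<Sum>i\<in>UNIV. \<xi> i \<bullet> H z (\<xi> i)) = -1"
      using eq_projected[OF x np(1)] eq_projected[OF y np(2)] eq_projected[OF z np(3)]
      by (simp_all only: nu \<xi>_def)
    have "0 \<le> (\<Sum>i\<in>UNIV. M\<^sup>2 / v z * (\<xi> i \<bullet> H z (\<xi> i)) - l * v x * (\<xi> i \<bullet> H x (\<xi> i)) - m * v y * (\<xi> i \<bullet> H y (\<xi> i)))"
      by (intro sum_nonneg ineq)
    also have "\<dots> = - (M\<^sup>2 / v z) + M"
      by (simp only: sum_subtractf flip: sum_distrib_left) (simp add: tr M_def)
    finally have "M * M \<le> M * v z" using pos by (simp add: field_simps power2_eq_square)
    then have "M \<le> v z" using \<open>M > 0\<close> by simp
    then show ?thesis by (simp add: M_def z_def)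
  qed
qed

text \<open>At the frontier \<open>v\<close> grows like a square root in the inward direction,
  so moving \<open>x\<close> inwards lowers the two-point function.\<close>

lemma two_point_frontier:
  assumes x: "x \<in> frontier \<Omega>" and z: "l *\<^sub>R x + w \<in> \<Omega>" and l: "0 < l"
    and min: "\<And>x'. x' \<in> \<Omega> \<Longrightarrow> v (l *\<^sub>R x + w) - l * v x \<le> v (l *\<^sub>R x' + w) - l * v x'"
  shows False
proof -
  define z where "z = l *\<^sub>R x + w"
  note z = z[folded z_def]
  let ?e = "p - x"
  define \<kappa> where "\<kappa> = ?e \<bullet> G x"
  have kappa: "\<kappa> > 0" using inward_derivative_pos[OF x] by (simp add: \<kappa>_def)
  have xc: "x \<in> closure \<Omega>" using x by (simp add: frontier_def)
  \<comment> \<open>The tolerance \<open>\<kappa> / 2\<close> leaves half of the linear growth of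
    \<open>u\<close>, so that \<open>v\<close> is at least \<open>sqrt (\<kappa> * s)\<close> along
    the segment.\<close>
  obtain d where d: "d > 0" "d \<le> 1"
    "\<And>s. 0 < s \<Longrightarrow> s < d \<Longrightarrow> \<bar>u (x + s *\<^sub>R ?e) - u0 - s * \<kappa>\<bar> \<le> \<kappa> / 2 * s"
    using expansion_at_frontier[OF x p, of "\<kappa> / 2"] kappa unfolding \<kappa>_def by auto
  \<comment> \<open>In contrast, \<open>v\<close> at the interior point \<open>z\<close> changes at
    most linearly, with slope below \<open>M = \<bar>D\<bar> + 1\<close>.\<close>
  define D where "D = ((l *\<^sub>R ?e) \<bullet> G z) / v z"
  have "((\<lambda>s. v (z + s *\<^sub>R (l *\<^sub>R ?e))) has_real_derivative D) (at 0)"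
    using v_derivative_along_line[of z 0 "l *\<^sub>R ?e"] z by (simp add: D_def)
  then have "((\<lambda>s. (v (z + s *\<^sub>R (l *\<^sub>R ?e)) - v z) / s) \<longlongrightarrow> D) (at 0)"
    by (simp add: DERIV_def)
  from tendstoD[OF this, of 1] obtain d' where d': "d' > 0"
    "\<And>s. s \<noteq> 0 \<Longrightarrow> \<bar>s\<bar> < d' \<Longrightarrow> \<bar>(v (z + s *\<^sub>R (l *\<^sub>R ?e)) - v z) / s - D\<bar> < 1"
    by (auto simp: eventually_at dist_real_def)
  define M where "M = \<bar>D\<bar> + 1"
  have M: "M > 0" by (simp add: M_def add_nonneg_pos)
  have bound: "l\<^sup>2 * \<kappa> \<le> M\<^sup>2 * s" if s: "0 < s" "s < d" "s < d'" for s
  proof -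
    have "(v (z + s *\<^sub>R (l *\<^sub>R ?e)) - v z) / s \<le> M"
      using d'(2)[of s] s by (simp add: M_def)
    then have up: "v (z + s *\<^sub>R (l *\<^sub>R ?e)) - v z \<le> M * s" using s(1) by (simp add: field_simps)
    have "\<kappa> * s \<le> 2 * (u (x + s *\<^sub>R ?e) - u0)"
      using d(3)[OF s(1,2)] abs_ge_minus_self[of "u (x + s *\<^sub>R ?e) - u0 - s * \<kappa>"]
        mult.commute[of s \<kappa>] by simp
    then have low: "sqrt (\<kappa> * s) \<le> v (x + s *\<^sub>R ?e)" by (simp add: v_def)
    have "x + s *\<^sub>R ?e \<in> \<Omega>" using segment_to_interior[OF xc p] s d(2) by simp
    from min[OF this] have "l * v (x + s *\<^sub>R ?e) \<le> v (z + s *\<^sub>R (l *\<^sub>R ?e)) - v z"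
      using v_frontier[OF x] by (simp add: z_def algebra_simps)
    then have "l * sqrt (\<kappa> * s) \<le> M * s" using up low l by (smt (verit) mult_left_mono)
    then have "(l * sqrt (\<kappa> * s))\<^sup>2 \<le> (M * s)\<^sup>2"
      using l kappa s by (intro power_mono) auto
    then have "(l\<^sup>2 * \<kappa>) * s \<le> (M\<^sup>2 * s) * s"
      using kappa s by (simp add: power_mult_distrib power2_eq_square mult_ac)
    then show ?thesis using s(1) by simp
  qed
  \<comment> \<open>The last term makes \<open>M\<^sup>2 * s\<close> at most half of the positive
    number \<open>l\<^sup>2 * \<kappa>\<close>, against \<open>bound\<close>.\<close>
  define s where "s = min (min (d / 2) (d' / 2)) (l\<^sup>2 * \<kappa> / (2 * M\<^sup>2))"
  have s: "0 < s" "s < d" "s < d'" using d(1) d'(1) l kappa M by (auto simp: s_def)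
  have "M\<^sup>2 * s \<le> M\<^sup>2 * (l\<^sup>2 * \<kappa> / (2 * M\<^sup>2))" by (intro mult_left_mono) (auto simp: s_def)
  also have "\<dots> = l\<^sup>2 * \<kappa> / 2" using M by simp
  finally have "M\<^sup>2 * s \<le> l\<^sup>2 * \<kappa> / 2" .
  moreover have "0 < l\<^sup>2 * \<kappa>" using l kappa by simp
  ultimately show False using bound[OF s] by linarith
qed

text \<open>The set of pairs is compact, so it suffices to show that the two-point function is
  nonnegative at a minimizing pair. What matters there is whether the combination of the pair lies
  in \<Omega>.\<close>

lemma two_point:
  assumes x: "x \<in> closure \<Omega>" and y: "y \<in> closure \<Omega>"
    and l: "0 < l" and m: "0 < m" and lm: "l + m = 1"
  shows "l * v x + m * v y \<le> v (l *\<^sub>R x + m *\<^sub>R y)"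
proof -
  define C where "C x y = v (l *\<^sub>R x + m *\<^sub>R y) - l * v x - m * v y" for x y
  have conv: "l *\<^sub>R x + m *\<^sub>R y \<in> closure \<Omega>" if "x \<in> closure \<Omega>" "y \<in> closure \<Omega>" for x y
    using convexD[OF convex_closure[OF convex] that] l m lm by simp
  have "continuous_on (closure \<Omega> \<times> closure \<Omega>) (\<lambda>w. C (fst w) (snd w))"
    unfolding C_def by (intro continuous_intros continuous_on_compose2[OF cont_v]) (auto intro: conv)
  moreover have "closure \<Omega> \<times> closure \<Omega> \<noteq> {}" using x by auto
  ultimately obtain w where "w \<in> closure \<Omega> \<times> closure \<Omega>"
      "\<And>w'. w' \<in> closure \<Omega> \<times> closure \<Omega> \<Longrightarrow> C (fst w) (snd w) \<le> C (fst w') (snd w')"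
    using continuous_attains_inf[OF compact_Times[OF compact_closure compact_closure]] by blast
  then obtain a b where a: "a \<in> closure \<Omega>" and b: "b \<in> closure \<Omega>"
    and min: "\<And>x y. x \<in> closure \<Omega> \<Longrightarrow> y \<in> closure \<Omega> \<Longrightarrow> C a b \<le> C x y"
    by (cases w) auto
  have sub: "x \<in> \<Omega> \<Longrightarrow> x \<in> closure \<Omega>" for x using closure_subset by blast
  have "0 \<le> C a b"
  proof (cases "l *\<^sub>R a + m *\<^sub>R b \<in> \<Omega>")
    case True
    have "a \<in> \<Omega>"
    proof (rule ccontr)
      assume "a \<notin> \<Omega>"
      then have "a \<in> frontier \<Omega>" using closure_cases[OF a] by blast
      then show False
      proof (rule two_point_frontier[OF _ True l])
        fix x' assume "x' \<in> \<Omega>"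
        from min[OF sub[OF this] b]
        show "v (l *\<^sub>R a + m *\<^sub>R b) - l * v a \<le> v (l *\<^sub>R x' + m *\<^sub>R b) - l * v x'"
          by (simp add: C_def)
      qed
    qed
    moreover have "b \<in> \<Omega>"
    proof (rule ccontr)
      assume "b \<notin> \<Omega>"
      then have "b \<in> frontier \<Omega>" using closure_cases[OF b] by blast
      then show False
      \<comment> \<open>The roles are exchanged: \<open>b\<close> moves with weight
        \<open>m\<close>, and \<open>l *\<^sub>R a\<close> is the fixed summand.\<close>
      proof (rule two_point_frontier[OF _ _ m])
        show "m *\<^sub>R b + l *\<^sub>R a \<in> \<Omega>" using True by (simp add: add.commute)
        fix y' assume "y' \<in> \<Omega>"
        from min[OF a sub[OF this]]
        show "v (m *\<^sub>R b + l *\<^sub>R a) - m * v b \<le> v (m *\<^sub>R y' + l *\<^sub>R a) - m * v y'"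
          by (simp add: C_def add.commute)
      qed
    qed
    ultimately have "l * v a + m * v b \<le> v (l *\<^sub>R a + m *\<^sub>R b)"
      using min[OF sub sub, unfolded C_def] by (rule two_point_interior[OF _ _ True l m lm])
    then show ?thesis by (simp add: C_def)
  next
    case False
    \<comment> \<open>By convexity, a single endpoint in \<Omega> would pull the combination into
      \<Omega>. So both endpoints and the combination are on the frontier, where \<open>v\<close>
      vanishes.\<close>
    have "a \<notin> \<Omega>"
    proof
      assume "a \<in> \<Omega>"
      from segment_to_interior[OF b this l] m lm have "b + l *\<^sub>R (a - b) \<in> \<Omega>" by simp
      moreover have "b + l *\<^sub>R (a - b) = l *\<^sub>R a + (1 - l) *\<^sub>R b" by (simp add: algebra_simps)
      moreover have "1 - l = m" using lm by simp
      ultimately show False using False by simp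
    qed
    moreover have "b \<notin> \<Omega>"
    proof
      assume "b \<in> \<Omega>"
      from segment_to_interior[OF a this m] l lm have "a + m *\<^sub>R (b - a) \<in> \<Omega>" by simp
      moreover have "a + m *\<^sub>R (b - a) = (1 - m) *\<^sub>R a + m *\<^sub>R b" by (simp add: algebra_simps)
      moreover have "1 - m = l" using lm by simp
      ultimately show False using False by simp
    qed
    ultimately have "v a = 0" "v b = 0" "v (l *\<^sub>R a + m *\<^sub>R b) = 0"
      using False closure_cases conv a b v_frontier by blast+
    then show ?thesis by (simp add: C_def)
  qed
  then show ?thesis using min[OF x y] by (simp add: C_def)
qed

lemma concave_sqrt: "concave_on (closure \<Omega>) (\<lambda>x. sqrt (2 * (u x - u0)))"
  unfolding concave_on_iff
proof (intro conjI ballI allI impI)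
  show "convex (closure \<Omega>)" by (rule convex_closure[OF convex])
  fix x y l m assume *: "x \<in> closure \<Omega>" "y \<in> closure \<Omega>" "0 \<le> l" "0 \<le> m" "l + m = (1::real)"
  then consider "l = 0" "m = 1" | "m = 0" "l = 1" | "0 < l" "0 < m" by fastforce
  then show "l * sqrt (2 * (u x - u0)) + m * sqrt (2 * (u y - u0)) \<le> sqrt (2 * (u (l *\<^sub>R x + m *\<^sub>R y) - u0))"
    using two_point[OF *(1,2) _ _ *(5)] by cases (auto simp: v_def)
qed

end

section \<open>Transfer from the stated hypotheses to the working setting\<close>

text \<open>\<open>G\<close> is kept general for the sake of both parts: in (a) it is an extension
  of the gradient to the closure, in (b) it is \<open>grad u\<close> itself, because the closure of
  a superlevel set stays inside the domain.\<close>

lemma concave_sqrt_arrival_time: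
  fixes \<Omega> :: "(real ^ 'n) set"
  assumes bounded: "bounded \<Omega>" and convex: "convex \<Omega>" and open_dom: "open \<Omega>" and p: "p \<in> \<Omega>"
    and cont_u: "continuous_on (closure \<Omega>) u" and diff: "\<And>x. x \<in> \<Omega> \<Longrightarrow> u differentiable (at x)"
    and cont_G: "continuous_on (closure \<Omega>) G" and G: "\<And>x. x \<in> \<Omega> \<Longrightarrow> G x = grad u x"
    and crit: "\<And>x. x \<in> closure \<Omega> \<Longrightarrow> G x = 0 \<longleftrightarrow> x = p"
    and diff2: "twice_differentiable_on_open (\<Omega> - {p}) u"
    and eq: "arrival_time_eq (\<Omega> - {p}) u"
    and bdry: "\<And>x. x \<in> frontier \<Omega> \<Longrightarrow> u x = u0"
  shows "concave_on (closure \<Omega>) (\<lambda>x. sqrt (2 * (u x - u0)))"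
proof -
  have sub: "x \<in> \<Omega> \<Longrightarrow> x \<in> closure \<Omega>" for x using closure_subset by blast
  define H where "H x = frechet_derivative (grad u) (at x)" for x
  have H: "(grad u has_derivative H x) (at x)" if "x \<in> \<Omega>" "x \<noteq> p" for x
    using diff2 that by (simp add: twice_differentiable_on_open_def H_def frechet_derivative_works)
  interpret arrival_time \<Omega> u u0 p G H
  proof
    show "(u has_derivative (\<lambda>h. h \<bullet> G x)) (at x)" if "x \<in> \<Omega>" for x
      using grad_GDERIV[OF diff[OF that]] G[OF that] by (simp add: gderiv_def)
    show "G p = 0" using crit p sub by blast
    show "G x \<noteq> 0" if "x \<in> closure \<Omega>" "x \<noteq> p" for x using crit that by blast
    show "(G has_derivative H x) (at x)" if "x \<in> \<Omega>" "x \<noteq> p" for x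
      \<comment> \<open>\<open>G\<close> and \<open>grad u\<close> agree on an open set, hence share
        their derivative at its points.\<close>
      using has_derivative_transform_within_open[OF H[OF that] open_dom that(1)] G by simp
    show "(\<Sum>i\<in>UNIV. H x (axis i 1) $ i) - sgn (G x) \<bullet> H x (sgn (G x)) = -1"
      if x: "x \<in> \<Omega>" "x \<noteq> p" for x
    proof -
      have "grad u x \<noteq> 0" using crit x sub G by force
      from divergence_normalized[OF H[OF x] this] eq x G[OF x(1)] show ?thesis
        by (fastforce simp: arrival_time_eq_def)
    qed
  qed (fact bounded convex open_dom p cont_u cont_G bdry)+
  show ?thesis by (rule concave_sqrt)
qed

section \<open>Superlevel sets and the passage to the limit for (b)\<close>

lemma continuous_on_grad:
  assumes "Ck_on 1 \<Omega> u"
  shows "continuous_on \<Omega> (grad u)"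
  using assms unfolding grad_def by (auto intro!: continuous_on_vec_lambda)

text \<open>As \<open>s \<rightarrow> \<infinity>\<close>, the functions \<open>2 * sqrt s * (sqrt (u + s) - sqrt s)\<close>, concave where
  \<open>sqrt (u + s)\<close> is, converge to \<open>u\<close>.\<close>

lemma concave_of_superlevel_sets:
  fixes u :: "'a :: real_vector \<Rightarrow> real"
  assumes conv: "convex \<Omega>"
    and lev: "\<And>t. t < T \<Longrightarrow> concave_on {x \<in> \<Omega>. u x > t} (\<lambda>x. sqrt (2 * (u x - t)))"
  shows "concave_on \<Omega> u"
  unfolding concave_on_iff
proof (intro conjI ballI allI impI)
  show "convex \<Omega>" by fact
  fix x y l m assume *: "x \<in> \<Omega>" "y \<in> \<Omega>" "0 \<le> l" "0 \<le> m" "l + m = (1::real)"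
  define f where "f a s = 2 * sqrt s * (sqrt (a + s) - sqrt s)" for a s :: real
  have lim: "(f a \<longlongrightarrow> a) at_top" for a
    unfolding f_def by real_asymp
  \<comment> \<open>The level used is \<open>- s\<close>; the bounds on \<open>s\<close> put it
    below \<open>T\<close> and put \<open>x\<close> and \<open>y\<close> into its superlevel
    set.\<close>
  have "l * f (u x) s + m * f (u y) s \<le> f (u (l *\<^sub>R x + m *\<^sub>R y)) s"
    if s: "s > 0" "s > - T" "s > - u x" "s > - u y" for s
  proof -
    have "l * sqrt (2 * (u x + s)) + m * sqrt (2 * (u y + s)) \<le> sqrt (2 * (u (l *\<^sub>R x + m *\<^sub>R y) + s))"
      using lev[of "- s"] s * unfolding concave_on_iff by simp
    then have "sqrt 2 * (l * sqrt (u x + s) + m * sqrt (u y + s)) \<le> sqrt 2 * sqrt (u (l *\<^sub>R x + m *\<^sub>R y) + s)"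
      unfolding real_sqrt_mult by (simp add: algebra_simps)
    then have "l * sqrt (u x + s) + m * sqrt (u y + s) \<le> sqrt (u (l *\<^sub>R x + m *\<^sub>R y) + s)"
      by simp
    \<comment> \<open>As \<open>l + m = 1\<close>, this subtracts the same \<open>sqrt s\<close>
      from both sides and scales by a positive factor.\<close>
    then have "2 * sqrt s * (l * sqrt (u x + s) + m * sqrt (u y + s) - (l + m) * sqrt s)
      \<le> 2 * sqrt s * (sqrt (u (l *\<^sub>R x + m *\<^sub>R y) + s) - sqrt s)"
      using s(1) *(5) by (intro mult_left_mono) auto
    then show ?thesis by (simp add: f_def algebra_simps)
  qed
  then have "eventually (\<lambda>s. l * f (u x) s + m * f (u y) s \<le> f (u (l *\<^sub>R x + m *\<^sub>R y)) s) at_top"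
    using eventually_gt_at_top[of "Max {0, - T, - u x, - u y}"] by (auto elim!: eventually_mono)
  then show "l * u x + m * u y \<le> u (l *\<^sub>R x + m *\<^sub>R y)"
    by (intro tendsto_le[OF _ lim tendsto_add[OF tendsto_mult_left[OF lim] tendsto_mult_left[OF lim]]]) auto
qed

text \<open>Near a frontier point of \<Omega> the values drop to at most \<open>t\<close>, so the
  closure cannot leave \<Omega>; inside \<Omega> continuity gives the bound. This supplies the
  constant boundary value \<open>t\<close> on the frontier of a superlevel set.\<close>

lemma closure_superlevel_subset:
  fixes u :: "'a :: metric_space \<Rightarrow> real"
  assumes cont: "continuous_on \<Omega> u" and op: "open \<Omega>"
    and bdry: "\<And>x. x \<in> frontier \<Omega> \<Longrightarrow> filterlim u at_bot (at x within \<Omega>)"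
  shows "closure {x \<in> \<Omega>. u x > t} \<subseteq> {x \<in> \<Omega>. u x \<ge> t}"
proof
  let ?L = "{x \<in> \<Omega>. u x > t}"
  fix x assume x: "x \<in> closure ?L"
  have "closure ?L \<subseteq> closure \<Omega>" by (intro closure_mono) auto
  then have xc: "x \<in> closure \<Omega>" using x by blast
  have "x \<in> \<Omega>"
  proof (rule ccontr)
    assume nx: "x \<notin> \<Omega>"
    then have "x \<in> frontier \<Omega>" using xc op by (simp add: frontier_def interior_open)
    from bdry[OF this] have "eventually (\<lambda>y. u y \<le> t) (at x within \<Omega>)"
      by (simp add: filterlim_at_bot)
    then obtain d where d: "d > 0" "\<And>y. y \<in> \<Omega> \<Longrightarrow> y \<noteq> x \<Longrightarrow> dist y x < d \<Longrightarrow> u y \<le> t"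
      by (auto simp: eventually_at)
    obtain y where "y \<in> ?L" "dist y x < d" using x d(1) by (meson closure_approachable)
    then show False using d(2)[of y] nx by force
  qed
  moreover have "u x \<ge> t"
  proof (rule ccontr)
    assume "\<not> u x \<ge> t"
    have "open (\<Omega> \<inter> u -` {..<t})"
      by (rule continuous_open_preimage[OF cont op]) simp
    moreover have "x \<in> \<Omega> \<inter> u -` {..<t}" using \<open>x \<in> \<Omega>\<close> \<open>\<not> u x \<ge> t\<close> by simp
    ultimately obtain y where "y \<in> ?L" "y \<in> \<Omega> \<inter> u -` {..<t}"
      using x open_Int_closure_eq_empty[of "\<Omega> \<inter> u -` {..<t}" ?L] by blast
    then show False by simp
  qed
  ultimately show "x \<in> {x \<in> \<Omega>. u x \<ge> t}" by simp
qed

section \<open>Assembly of the bounded case and the case of boundary value minus infinity\<close>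

theorem theorem2p1:
  shows
   "(\<forall>(\<Omega> :: (real ^ 'n) set) (u0 :: real) (u :: real ^ 'n \<Rightarrow> real) (p :: real ^ 'n).
       bounded \<Omega> \<and> convex \<Omega> \<and> open \<Omega> \<and> smooth_boundary \<Omega> \<and>
       C1_on_closure \<Omega> u \<and>
       p \<in> \<Omega> \<and> {x \<in> closure \<Omega>. closure_grad \<Omega> u x = 0} = {p} \<and>
       twice_differentiable_on_open (\<Omega> - {p}) u \<and>
       arrival_time_eq (\<Omega> - {p}) u \<and>
       (\<forall>x\<in>frontier \<Omega>. u x = u0)
       \<longrightarrow> concave_on (closure \<Omega>) (\<lambda>x. sqrt (2 * (u x - u0))))
    \<and>
    (\<forall>(\<Omega> :: (real ^ 'n) set) (u :: real ^ 'n \<Rightarrow> real) (p :: real ^ 'n).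
       convex \<Omega> \<and> open \<Omega> \<and> smooth_boundary \<Omega> \<and>
       Ck_on 1 \<Omega> u \<and>
       p \<in> \<Omega> \<and> {x \<in> \<Omega>. grad u x = 0} = {p} \<and>
       twice_differentiable_on_open (\<Omega> - {p}) u \<and>
       arrival_time_eq (\<Omega> - {p}) u \<and>
       (\<forall>x\<in>frontier \<Omega>. filterlim u at_bot (at x within \<Omega>)) \<and>
       (\<forall>t < u p. bounded {q \<in> \<Omega>. u q > t} \<and> convex {q \<in> \<Omega>. u q > t})
       \<longrightarrow> concave_on \<Omega> u)"
proof (intro conjI allI impI; elim conjE)
  fix \<Omega> :: "(real ^ 'n) set" and u0 :: real and u :: "real ^ 'n \<Rightarrow> real" and p
  assume \<Omega>: "bounded \<Omega>" "convex \<Omega>" "open \<Omega>" and C1: "C1_on_closure \<Omega> u" and p: "p \<in> \<Omega>"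
    and crit: "{x \<in> closure \<Omega>. closure_grad \<Omega> u x = 0} = {p}"
    and pde: "twice_differentiable_on_open (\<Omega> - {p}) u" "arrival_time_eq (\<Omega> - {p}) u"
    and bdry: "\<forall>x\<in>frontier \<Omega>. u x = u0"
  obtain G where G: "continuous_on (closure \<Omega>) G" "\<And>x. x \<in> \<Omega> \<Longrightarrow> G x = grad u x"
    using C1 unfolding C1_on_closure_def by blast
  show "concave_on (closure \<Omega>) (\<lambda>x. sqrt (2 * (u x - u0)))"
  proof (rule concave_sqrt_arrival_time[OF \<Omega> p _ _ G _ pde])
    show "G x = 0 \<longleftrightarrow> x = p" if "x \<in> closure \<Omega>" for x
    proof -
      \<comment> \<open>This identifies the critical points counted on the whole closure with the
        zeros of \<open>G\<close>; in particular \<open>G\<close> is nonzero on the frontier, as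
        \<open>inward_derivative_pos\<close> requires.\<close>
      have "closure_grad \<Omega> u x = G x" by (rule closure_grad_eq[OF \<Omega>(3) G that])
      then have "G x = 0 \<longleftrightarrow> x \<in> {x \<in> closure \<Omega>. closure_grad \<Omega> u x = 0}"
        using that by simp
      then show ?thesis unfolding crit by simp
    qed
    show "continuous_on (closure \<Omega>) u" using C1 by (simp add: C1_on_closure_def)
    show "u differentiable (at x)" if "x \<in> \<Omega>" for x using C1 that by (simp add: C1_on_closure_def)
    show "u x = u0" if "x \<in> frontier \<Omega>" for x using bdry that by blast
  qed
next
  fix \<Omega> :: "(real ^ 'n) set" and u :: "real ^ 'n \<Rightarrow> real" and p
  assume \<Omega>: "convex \<Omega>" "open \<Omega>" and C1: "Ck_on 1 \<Omega> u" and p: "p \<in> \<Omega>"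
    and crit: "{x \<in> \<Omega>. grad u x = 0} = {p}"
    and pde: "twice_differentiable_on_open (\<Omega> - {p}) u" "arrival_time_eq (\<Omega> - {p}) u"
    and bdry: "\<forall>x\<in>frontier \<Omega>. filterlim u at_bot (at x within \<Omega>)"
    and lev: "\<forall>t<u p. bounded {q \<in> \<Omega>. t < u q} \<and> convex {q \<in> \<Omega>. t < u q}"
  have diff: "u differentiable (at x)" if "x \<in> \<Omega>" for x using C1 that by simp
  then have cont: "continuous_on \<Omega> u"
    by (meson continuous_at_imp_continuous_on differentiable_imp_continuous_within)
  show "concave_on \<Omega> u"
  proof (rule concave_of_superlevel_sets[OF \<Omega>(1)])
    \<comment> \<open>Only levels below \<open>u p\<close> are used, so that \<open>p\<close>
      belongs to the superlevel set and is its single critical point.\<close>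
    fix t assume t: "t < u p"
    let ?L = "{q \<in> \<Omega>. u q > t}"
    have cl: "closure ?L \<subseteq> {x \<in> \<Omega>. u x \<ge> t}"
      using closure_superlevel_subset[OF cont \<Omega>(2)] bdry by blast
    then have cl\<Omega>: "closure ?L \<subseteq> \<Omega>" by blast
    have "?L = \<Omega> \<inter> u -` {t<..}" by auto
    then have op: "open ?L" using continuous_open_preimage[OF cont \<Omega>(2)] by simp
    have "concave_on (closure ?L) (\<lambda>x. sqrt (2 * (u x - t)))"
    proof (rule concave_sqrt_arrival_time[where G = "grad u" and p = p])
      show "continuous_on (closure ?L) u" "continuous_on (closure ?L) (grad u)"
        using continuous_on_subset[OF cont cl\<Omega>] continuous_on_subset[OF continuous_on_grad[OF C1] cl\<Omega>]
        by auto
      show "grad u x = 0 \<longleftrightarrow> x = p" if "x \<in> closure ?L" for x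
        using crit cl\<Omega> that by blast
      show "twice_differentiable_on_open (?L - {p}) u" "arrival_time_eq (?L - {p}) u"
        using pde by (auto simp: twice_differentiable_on_open_def arrival_time_eq_def)
      \<comment> \<open>A frontier point of the open set \<open>?L\<close> lies in its closure,
        where \<open>u x \<ge> t\<close>, but not in \<open>?L\<close>, which excludes
        \<open>u x > t\<close>.\<close>
      show "u x = t" if "x \<in> frontier ?L" for x
        using that cl op by (auto simp: frontier_def interior_open)
    qed (use lev t op p diff in auto)
    moreover have "convex ?L" using lev t by blast
    ultimately show "concave_on ?L (\<lambda>x. sqrt (2 * (u x - t)))"
      using closure_subset[of ?L] unfolding concave_on_iff by blast
  qed
qed

end
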